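(* Let $L>0$ and $\nu>0$, and let $f:\mathbb{R}^d\to\mathbb{R}$ be differentiable, convex and $L$-smooth. Suppose that the solution set $\mathcal{X}^*$ of the unconstrained problem $\min_{x\in\mathbb{R}^d} f(x)$ is nonempty, let $\bar f$ be the optimal function value, and suppose that $f$ satisfies the Polyak-Łojasiewicz inequality $$\tfrac12\|\nabla f(x)\|^2\ \ge\ \nu\,(f(x)-\bar f)\qquad \forall x\in\mathbb{R}^d.$$ Let $x_0\in\mathbb{R}^d$ be arbitrary and let $(x_k)_{k\ge 0}$ be generated by gradient descent with step size $\frac1L$, i.e. $x_{k+1}=x_k-\frac1L\nabla f(x_k)$ for $k\ge 0$. Then for all $k\ge 0$, $$f(x_{k+1})-\bar f\ \le\ \frac{L-\nu}{L+\nu}\,\bigl(f(x_k)-\bar f\bigr).$$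
   Context: $\mathbb{R}^d$ carries the dot product $\langle\cdot,\cdot\rangle$ and the induced Euclidean norm $\|\cdot\|$. A differentiable function $f:\mathbb{R}^d\to\mathbb{R}$ is called $L$-smooth if $f(x)-f(y)-\langle\nabla f(y),x-y\rangle\le \frac L2\|x-y\|^2$ for all $x,y\in\mathbb{R}^d$. The solution set $\mathcal{X}^*$ is the set of minimizers of $f$ over $\mathbb{R}^d$. *)

theory Defs
  imports "HOL-Analysis.Analysis"
begin

(* Meaningful only where f is differentiable; see GDERIV_grad. *)
definition grad :: "('a::euclidean_space \<Rightarrow> real) \<Rightarrow> 'a \<Rightarrow> 'a" where
  "grad f x = (THE D. GDERIV f x :> D)"

(* Only the quadratic upper bound; differentiability of f is assumed separately. *)
definition L_smooth :: "real \<Rightarrow> ('a::euclidean_space \<Rightarrow> real) \<Rightarrow> bool" where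
  "L_smooth L f \<longleftrightarrow>
     (\<forall>x y. f x - f y - inner (grad f y) (x - y) \<le> L / 2 * (norm (x - y))\<^sup>2)"

definition solution_set :: "('a \<Rightarrow> real) \<Rightarrow> 'a set" where
  "solution_set f = {x. is_arg_min f (\<lambda>_. True) x}"

(* The infimum over an unbounded-below range is unspecified; it is the minimum of f
   as soon as the solution set is nonempty; see opt_value_eq. *)
definition opt_value :: "('a \<Rightarrow> real) \<Rightarrow> real" where
  "opt_value f = (INF x. f x)"

definition PL_inequality :: "real \<Rightarrow> ('a::euclidean_space \<Rightarrow> real) \<Rightarrow> bool" where
  "PL_inequality \<nu> f \<longleftrightarrow>
     (\<forall>x. 1 / 2 * (norm (grad f x))\<^sup>2 \<ge> \<nu> * (f x - opt_value f))"

lemma grad_eqI: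
  assumes "GDERIV f x :> D"
  shows "grad f x = D"
  unfolding grad_def
proof (rule the_equality)
  fix E assume "GDERIV f x :> E"
  then have "(\<lambda>h. inner h E) = (\<lambda>h. inner h D)"
    using assms unfolding gderiv_def by (rule has_derivative_unique)
  then have "\<forall>h. inner h E = inner h D" by meson
  then show "E = D" by (metis vector_eq_ldot)
qed (rule assms)

lemma GDERIV_grad:
  fixes f :: "'a::euclidean_space \<Rightarrow> real"
  assumes "f differentiable (at x)"
  shows "GDERIV f x :> grad f x"
proof -
  obtain f' where f': "(f has_derivative f') (at x)"
    using assms unfolding differentiable_def by blast
  define D where "D = (\<Sum>b\<in>Basis. f' b *\<^sub>R b)"
  have "f' h = inner h D" for h
  proof -
    have "linear f'" using f' by (rule has_derivative_linear)
    then have "f' (\<Sum>b\<in>Basis. inner h b *\<^sub>R b) = (\<Sum>b\<in>Basis. inner h b * f' b)"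
      by (simp add: linear_sum linear_scale)
    then show ?thesis
      by (simp add: D_def inner_sum_right euclidean_representation mult.commute)
  qed
  then have "GDERIV f x :> D"
    using f' unfolding gderiv_def by presburger
  then show ?thesis by (simp add: grad_eqI)
qed

lemma opt_value_eq:
  assumes "z \<in> solution_set f"
  shows "opt_value f = f z"
  unfolding opt_value_def
  using assms by (intro cInf_eq_minimum) (auto simp: solution_set_def is_arg_min_linorder)

end

theory Submission
  imports Defs
begin

text \<open>
  The rate (L - \<nu>) / (L + \<nu>) comes from using the Polyak-Lojasiewicz inequality at both ends
  of a gradient step. For a convex L-smooth function the linear lower bound on f improves to
  f z - f y - \<langle>grad f y, z - y\<rangle> \<ge> \<parallel>grad f z - grad f y\<parallel>^2 / (2L) (lemma
  \<open>convex_L_smooth_lower_bound\<close>). Taking z = x and for y the next iterate, so that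
  z - y = grad f x / L, the inner products cancel, which leaves the decrease estimate
  f x - f y \<ge> (\<parallel>grad f x\<parallel>^2 + \<parallel>grad f y\<parallel>^2) / (2L) (lemma \<open>gradient_step_decrease\<close>).
  Writing a and b for the optimality gaps before and after the step, the PL inequality bounds
  the two squared gradients below by 2\<nu>a and 2\<nu>b. Hence a - b \<ge> (\<nu> / L) (a + b), that is,
  (L + \<nu>) b \<le> (L - \<nu>) a.
\<close>

text \<open>Restricting f to the line through y and z reduces this to the tangent inequality for convex
  functions of one real variable.\<close>
lemma convex_gradient_inequality:
  fixes f :: "'a::euclidean_space \<Rightarrow> real"
  assumes conv: "convex_on UNIV f" and diff: "f differentiable (at y)"
  shows "f z \<ge> f y + inner (grad f y) (z - y)"
proof -
  define \<phi> where "\<phi> = (\<lambda>t::real. f (y + t *\<^sub>R (z - y)))"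
  have "convex_on UNIV \<phi>"
  proof (rule convex_onI)
    fix t a b :: real
    assume "0 < t" "t < 1"
    moreover have "y + ((1 - t) *\<^sub>R a + t *\<^sub>R b) *\<^sub>R (z - y)
        = (1 - t) *\<^sub>R (y + a *\<^sub>R (z - y)) + t *\<^sub>R (y + b *\<^sub>R (z - y))"
      by (simp add: algebra_simps)
    ultimately show "\<phi> ((1 - t) *\<^sub>R a + t *\<^sub>R b) \<le> (1 - t) * \<phi> a + t * \<phi> b"
      using convex_onD[OF conv, of t] by (simp add: \<phi>_def)
  qed simp
  moreover have "(\<phi> has_field_derivative inner (grad f y) (z - y)) (at 0)"
  proof -
    have "(f has_derivative (\<lambda>h. inner h (grad f y))) (at (y + 0 *\<^sub>R (z - y)))"
      using GDERIV_grad[OF diff] by (simp add: gderiv_def)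
    moreover have "((\<lambda>t. y + t *\<^sub>R (z - y)) has_derivative (\<lambda>t. t *\<^sub>R (z - y))) (at 0)"
      by (auto intro!: derivative_eq_intros)
    ultimately have "(\<phi> has_derivative (\<lambda>t. inner (t *\<^sub>R (z - y)) (grad f y))) (at 0)"
      unfolding \<phi>_def by (rule has_derivative_compose[rotated])
    then show ?thesis
      by (simp add: has_field_derivative_def inner_commute mult_commute_abs)
  qed
  ultimately have "\<phi> 1 - \<phi> 0 \<ge> inner (grad f y) (z - y) * (1 - 0)"
    by (intro convex_on_imp_above_tangent[where A = UNIV]) auto
  then show ?thesis by (simp add: \<phi>_def)
qed

text \<open>The tangent of f at y bounds f below everywhere, and smoothness bounds f above by a quadratic
  model around z. Comparing the two at the point where the difference of model and tangent is
  smallest gives the gain over the plain gradient inequality.\<close>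
lemma convex_L_smooth_lower_bound:
  fixes f :: "'a::euclidean_space \<Rightarrow> real"
  assumes "L > 0" and conv: "convex_on UNIV f" and diff: "f differentiable (at y)"
    and smooth: "L_smooth L f"
  shows "f z \<ge> f y + inner (grad f y) (z - y) + (norm (grad f z - grad f y))\<^sup>2 / (2 * L)"
proof -
  define g where "g = grad f z - grad f y"
  \<comment> \<open>The minimizer over w of
    f z + \<langle>grad f z, w - z\<rangle> + L/2 \<parallel>w - z\<parallel>^2 - \<langle>grad f y, w\<rangle>.\<close>
  define w where "w = z - (1 / L) *\<^sub>R g"
  have upper: "f w \<le> f z - inner (grad f z) g / L + (norm g)\<^sup>2 / (2 * L)"
  proof -
    have "f w - f z - inner (grad f z) (w - z) \<le> L / 2 * (norm (w - z))\<^sup>2"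
      using smooth unfolding L_smooth_def by blast
    moreover have "L / 2 * (norm (w - z))\<^sup>2 = (norm g)\<^sup>2 / (2 * L)"
      using \<open>L > 0\<close> by (simp add: w_def power_divide power2_eq_square)
    ultimately show ?thesis
      by (simp add: w_def)
  qed
  have lower: "f w \<ge> f y + inner (grad f y) (z - y) - inner (grad f y) g / L"
    using convex_gradient_inequality[OF conv diff, of w]
    by (simp add: w_def inner_diff_right)
  have "inner (grad f z) g / L - inner (grad f y) g / L = (norm g)\<^sup>2 / L"
    by (simp add: g_def power2_norm_eq_inner inner_diff_left diff_divide_distrib)
  moreover have "(norm g)\<^sup>2 / L = 2 * ((norm g)\<^sup>2 / (2 * L))"
    by simp
  ultimately show ?thesis
    using upper lower unfolding g_def by linarith
qed

text \<open>The length 1 / L of the step is what makes the mixed term of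
  \<parallel>grad f x - grad f y\<parallel>^2 / (2L) cancel against \<langle>grad f y, x - y\<rangle>.\<close>
lemma gradient_step_decrease:
  fixes f :: "'a::euclidean_space \<Rightarrow> real"
  assumes "L > 0" and "convex_on UNIV f" and "f differentiable (at y)" and "L_smooth L f"
    and y: "y = x - (1 / L) *\<^sub>R grad f x"
  shows "f x - f y \<ge> ((norm (grad f x))\<^sup>2 + (norm (grad f y))\<^sup>2) / (2 * L)"
proof -
  have "x - y = (1 / L) *\<^sub>R grad f x"
    using y by simp
  then have "inner (grad f y) (x - y) = 2 * inner (grad f x) (grad f y) / (2 * L)"
    by (simp add: inner_commute)
  moreover have "(norm (grad f x - grad f y))\<^sup>2
      = (norm (grad f x))\<^sup>2 + (norm (grad f y))\<^sup>2 - 2 * inner (grad f x) (grad f y)"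
    by (simp add: power2_norm_eq_inner inner_diff_left inner_diff_right inner_commute)
  ultimately have "inner (grad f y) (x - y) + (norm (grad f x - grad f y))\<^sup>2 / (2 * L)
      = ((norm (grad f x))\<^sup>2 + (norm (grad f y))\<^sup>2) / (2 * L)"
    by (simp add: add_divide_distrib diff_divide_distrib)
  then show ?thesis
    using convex_L_smooth_lower_bound[OF assms(1-4), of x] by linarith
qed

theorem proposition4p1:
  fixes f :: "real ^ 'd \<Rightarrow> real"
    and L \<nu> :: real
    and x :: "nat \<Rightarrow> real ^ 'd"
    and x0 :: "real ^ 'd"
  assumes "L > 0"
    and "\<nu> > 0"
    and "\<forall>y. f differentiable (at y)"
    and "convex_on UNIV f"
    and "L_smooth L f"
    and "solution_set f \<noteq> {}"
    and "PL_inequality \<nu> f"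
    and "x 0 = x0"
    and "\<forall>k. x (Suc k) = x k - (1 / L) *\<^sub>R grad f (x k)"
  shows "\<forall>k. f (x (Suc k)) - opt_value f \<le> (L - \<nu>) / (L + \<nu>) * (f (x k) - opt_value f)"
proof
  fix k
  define a where "a = f (x k) - opt_value f"
  define b where "b = f (x (Suc k)) - opt_value f"
  have PL: "(norm (grad f u))\<^sup>2 \<ge> 2 * (\<nu> * (f u - opt_value f))" for u
    using assms(7) unfolding PL_inequality_def by (auto dest: spec[of _ u])
  have "f (x k) - f (x (Suc k))
      \<ge> ((norm (grad f (x k)))\<^sup>2 + (norm (grad f (x (Suc k))))\<^sup>2) / (2 * L)"
    using assms by (intro gradient_step_decrease) auto
  then have "2 * L * (a - b) \<ge> (norm (grad f (x k)))\<^sup>2 + (norm (grad f (x (Suc k))))\<^sup>2"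
    using \<open>L > 0\<close> by (simp add: a_def b_def field_simps)
  then have "2 * L * (a - b) \<ge> 2 * (\<nu> * a) + 2 * (\<nu> * b)"
    using PL[of "x k"] PL[of "x (Suc k)"] unfolding a_def b_def by linarith
  then have "b * (L + \<nu>) \<le> (L - \<nu>) * a"
    by (simp add: algebra_simps)
  then have "b \<le> (L - \<nu>) / (L + \<nu>) * a"
    using \<open>L > 0\<close> \<open>\<nu> > 0\<close> by (simp add: pos_le_divide_eq)
  then show "f (x (Suc k)) - opt_value f \<le> (L - \<nu>) / (L + \<nu>) * (f (x k) - opt_value f)"
    by (simp add: a_def b_def)
qed

end
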